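(* Let $d\ge 1$ be a fixed integer and $q$ a fixed prime power. For $n\ge 1$, choose $a_0(x),\ldots,a_{n-1}(x)\in\mathbb{F}_q[x]$ independently and uniformly at random from the set of polynomials of degree at most $d$, and let $$f(x,y)=y^n+a_{n-1}(x)y^{n-1}+\cdots+a_1(x)y+a_0(x)\in\mathbb{F}_q[x][y].$$ Then $$\lim_{n\to\infty}\mathbb{P}(f\text{ is irreducible})=1-\frac{1}{q^d}.$$
   Context: Irreducibility of $f$ is as a polynomial in $y$ over $\mathbb{F}_q(x)$ (equivalently, since $f$ is monic in $y$, in $\mathbb{F}_q[x,y]$). *)

theory Defs
  imports
    "HOL-Probability.Probability"
    "HOL-Computational_Algebra.Computational_Algebra"
begin

definition polys_deg_le :: "nat \<Rightarrow> 'a::{field,finite} poly set" where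
  "polys_deg_le d = {p. degree p \<le> d}"

lemma zero_in_polys_deg_le: "0 \<in> polys_deg_le d"
  by (simp add: polys_deg_le_def)

text \<open>
  The library's \<^const>\<open>pmf_of_set\<close> is meaningful only for finite nonempty sets.
\<close>

lemma finite_polys_deg_le: "finite (polys_deg_le d :: 'a::{field,finite} poly set)"
proof (rule finite_subset)
  show "(polys_deg_le d :: 'a poly set) \<subseteq> Poly ` {xs. set xs \<subseteq> UNIV \<and> length xs \<le> Suc d}"
  proof
    fix p :: "'a poly" assume "p \<in> polys_deg_le d"
    then have "length (coeffs p) \<le> Suc d"
      by (cases "p = 0") (auto simp: polys_deg_le_def length_coeffs_degree)
    then show "p \<in> Poly ` {xs. set xs \<subseteq> UNIV \<and> length xs \<le> Suc d}"
      by (intro image_eqI[of _ _ "coeffs p"]) auto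
  qed
  show "finite (Poly ` {xs :: 'a list. set xs \<subseteq> UNIV \<and> length xs \<le> Suc d})"
    by (intro finite_imageI finite_lists_length_le) simp
qed

text \<open>
  Coefficient families are functions on all of \<^typ>\<open>nat\<close>; those in the support of
  this distribution vanish outside \<open>{..<n}\<close>.
\<close>

definition random_coeffs :: "nat \<Rightarrow> nat \<Rightarrow> (nat \<Rightarrow> 'a::{field,finite} poly) pmf" where
  "random_coeffs d n = Pi_pmf {..<n} 0 (\<lambda>_. pmf_of_set (polys_deg_le d))"

text \<open>
  In \<^typ>\<open>'a poly poly\<close> the outer variable is \<open>y\<close> and the inner one is \<open>x\<close>.
\<close>

definition monic_with_coeffs :: "nat \<Rightarrow> (nat \<Rightarrow> 'a::field poly) \<Rightarrow> 'a poly poly" where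
  "monic_with_coeffs n a = monom 1 n + (\<Sum>i<n. monom (a i) i)"

definition irreducible_over_rational_functions :: "'a::field poly poly \<Rightarrow> bool" where
  "irreducible_over_rational_functions f \<longleftrightarrow> irreducible (map_poly to_fract f)"

end

theory Submission
  imports Defs "Berlekamp_Zassenhaus.Unique_Factorization_Poly"
begin

text \<open>
  Read as a polynomial in \<open>x\<close>, \<open>f\<close> has \<open>d + 1\<close> coefficients in \<open>F\<^sub>q[y]\<close>, one of them monic
  of degree \<open>n\<close> and the others arbitrary of degree \<open>< n\<close>. Splitting off their monic gcd gives
  \<open>q\<^bsup>(d+1)n\<^esup> = (\<Sum>k\<le>n. q\<^bsup>k\<^esup> N(n - k))\<close>, where \<open>N(m)\<close> counts the coprime families; hence the
  coefficients are coprime with probability exactly \<open>1 - q\<^bsup>-d\<^esup>\<close> for every \<open>n \<ge> 1\<close>.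

  An irreducible \<open>f\<close> with non-coprime coefficients lies in \<open>F\<^sub>q[y]\<close>, which allows only \<open>q\<^bsup>n\<^esup>\<close>
  polynomials. By Gauss's lemma a reducible \<open>f\<close> with coprime coefficients is a product of two monic
  factors, both of positive degree in \<open>x\<close> and hence both of \<open>x\<close>-degree at most \<open>d - 1\<close>, which
  allows at most \<open>n q\<^bsup>dn\<^esup>\<close> products. Both counts are negligible against \<open>q\<^bsup>(d+1)n\<^esup>\<close>.
\<close>

section \<open>Exchanging the two variables\<close>

definition swap_xy :: "'a::comm_monoid_add poly poly \<Rightarrow> 'a poly poly" where
  "swap_xy f = (\<Sum>i\<le>degree f. map_poly (\<lambda>c. monom c i) (coeff f i))"

text \<open>
  \<^term>\<open>degree (swap_xy f)\<close> is the \<open>x\<close>-degree of \<open>f\<close>, and \<^term>\<open>swap_xy [:g:]\<close> is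
  \<open>g(y)\<close> as a polynomial in both variables.
\<close>

lemma coeff_coeff_swap_xy [simp]: "coeff (coeff (swap_xy f) j) i = coeff (coeff f i) j"
  by (simp add: swap_xy_def coeff_sum coeff_map_poly coeff_eq_0)

lemma swap_xy_swap_xy [simp]: "swap_xy (swap_xy f) = f"
  by (intro poly_eqI) simp

lemma coeff_coeff_mult:
  "coeff (coeff (f * g) m) n =
     (\<Sum>i\<le>m. \<Sum>j\<le>n. coeff (coeff f i) j * coeff (coeff g (m - i)) (n - j))"
  by (simp add: coeff_mult coeff_sum)

interpretation swap_xy: comm_ring_isom "swap_xy :: 'a::comm_ring_1 poly poly \<Rightarrow> 'a poly poly"
proof
  show "swap_xy (f + g) = swap_xy f + swap_xy g" for f g :: "'a poly poly"
    by (intro poly_eqI) simp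
  show "swap_xy (f * g) = swap_xy f * swap_xy g" for f g :: "'a poly poly"
    by (intro poly_eqI) (simp add: coeff_coeff_mult, rule sum.swap)
  show "swap_xy 0 = (0 :: 'a poly poly)"
    by (simp add: swap_xy_def)
  show "swap_xy 1 = (1 :: 'a poly poly)"
    by (intro poly_eqI) (simp add: coeff_1)
  show "surj (swap_xy :: 'a poly poly \<Rightarrow> 'a poly poly)"
    using swap_xy_swap_xy by (rule surjI)
  show "f = 0" if "swap_xy f = 0" for f :: "'a poly poly"
    using swap_xy_swap_xy[of f] that by (simp add: swap_xy_def)
qed

lemma swap_xy_const: "swap_xy [:g:] = map_poly (\<lambda>c. [:c:]) g"
  by (simp add: swap_xy_def monom_0)

lemma degree_swap_xy_const [simp]: "degree (swap_xy [:g:]) = degree g"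
  by (simp add: swap_xy_const degree_map_poly)

lemma coeff_swap_xy_const [simp]: "coeff (swap_xy [:g:]) i = [:coeff g i:]"
  by (simp add: swap_xy_const coeff_map_poly)

lemma const_poly_eq_1_iff [simp]: "[:c:] = 1 \<longleftrightarrow> c = 1"
  by (simp only: one_pCons pCons_eq_iff simp_thms)

lemma degree_swap_xy_le_iff: "degree (swap_xy f) \<le> d \<longleftrightarrow> (\<forall>i. degree (coeff f i) \<le> d)"
proof
  assume "degree (swap_xy f) \<le> d"
  then have "coeff (swap_xy f) j = 0" if "j > d" for j
    using that by (simp add: coeff_eq_0)
  then have "coeff (coeff f i) j = 0" if "j > d" for i j
    using that by (metis coeff_0 coeff_coeff_swap_xy)
  then show "\<forall>i. degree (coeff f i) \<le> d"
    by (simp add: degree_le)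
next
  assume "\<forall>i. degree (coeff f i) \<le> d"
  then have "coeff (coeff f i) j = 0" if "j > d" for i j
    using that by (meson coeff_eq_0 le_less_trans)
  then show "degree (swap_xy f) \<le> d"
    by (intro degree_le) (simp add: poly_eq_iff)
qed

section \<open>Content and Gauss's lemma\<close>

lemma const_poly_dvd_iff_coeffs:
  fixes p :: "'a::{comm_semiring_1,semiring_no_zero_divisors} poly"
  shows "[:c:] dvd p \<longleftrightarrow> (\<forall>a\<in>set (coeffs p). c dvd a)"
proof -
  have "[:c:] dvd p \<longleftrightarrow> (\<forall>a\<in>range (coeff p). c dvd a)"
    by (simp add: const_poly_dvd_iff)
  then show ?thesis
    by (simp add: range_coeff)
qed

lemma primitive_iff_const_dvd:
  fixes p :: "'a::{comm_semiring_1,semiring_no_zero_divisors} poly"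
  shows "primitive p \<longleftrightarrow> (\<forall>c. [:c:] dvd p \<longrightarrow> c dvd 1)"
  by (simp add: primitive_def const_poly_dvd_iff_coeffs)

text \<open>
  The polynomials over an arbitrary field form a unique factorization domain but are not an instance
  of the gcd classes, so the content is expressed by \<open>some_gcd\<close>.
\<close>

lemma content_exists:
  fixes p :: "'a::ufd poly"
  obtains c where "\<And>a. [:a:] dvd p \<longleftrightarrow> a dvd c"
proof
  fix a
  show "[:a:] dvd p \<longleftrightarrow> a dvd some_gcd.listgcd (coeffs p)"
    unfolding const_poly_dvd_iff_coeffs
    by (meson dvd_trans some_gcd.listgcd some_gcd.listgcd_greatest)
qed

lemma primitive_if_smult_content:
  fixes p :: "'a::idom poly"
  assumes "smult c p \<noteq> 0" and "\<And>a. [:a:] dvd smult c p \<longleftrightarrow> a dvd c"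
  shows "primitive p"
  unfolding primitive_iff_const_dvd
proof (intro allI impI)
  fix a
  assume "[:a:] dvd p"
  then have "[:c * a:] dvd smult c p"
    using mult_dvd_mono[OF dvd_refl, of "[:a:]" p "[:c:]"] by (simp add: mult.commute)
  then have "c * a dvd c * 1"
    by (simp add: assms(2))
  moreover have "c \<noteq> 0"
    using assms(1) by auto
  ultimately show "a dvd 1"
    by (simp only: dvd_mult_cancel_left) simp
qed

lemma monic_content_factorization:
  fixes p :: "'a::field poly poly"
  assumes "p \<noteq> 0"
  obtains g h where "monic g" and "primitive h" and "p = smult g h"
proof -
  obtain c where c_iff: "\<And>a. [:a:] dvd p \<longleftrightarrow> a dvd c"
    using content_exists by blast
  then have "[:c:] dvd p"
    by simp
  then have "c \<noteq> 0"
    using assms by auto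
  define g where "g = smult (inverse (lead_coeff c)) c"
  have "monic g"
    using \<open>c \<noteq> 0\<close> by (simp add: g_def)
  have g_iff: "[:a:] dvd p \<longleftrightarrow> a dvd g" for a
    using \<open>c \<noteq> 0\<close> by (simp add: c_iff g_def dvd_smult_iff)
  then have "[:g:] dvd p"
    by simp
  then obtain h where p_eq: "p = smult g h"
    by (auto elim!: dvdE)
  have "primitive h"
    using assms g_iff unfolding p_eq by (rule primitive_if_smult_content)
  then show thesis
    using \<open>monic g\<close> p_eq by (intro that)
qed

lemma smult_eq_smult_primitive_imp_dvd:
  fixes p q :: "'a::ufd poly"
  assumes "smult a p = smult b q" and "primitive q"
  shows "a dvd b"
proof -
  have "a dvd c * b" if "c \<in> set (coeffs q)" for c
  proof -
    from that have "c \<in> range (coeff q)"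
      by (simp add: range_coeff)
    then obtain i where "c = coeff q i"
      by blast
    then have "a * coeff p i = c * b"
      using arg_cong[OF assms(1), of "\<lambda>r. coeff r i"] by (simp add: mult.commute)
    then show ?thesis
      by (metis dvd_triv_left)
  qed
  then have "a dvd some_gcd.listgcd (coeffs q) * b"
    by (rule some_gcd.listgcd_greatest_mult)
  moreover have "some_gcd.listgcd (coeffs q) dvd 1"
    using assms(2) by (simp add: primitive_iff_some_content_dvd_1)
  ultimately show ?thesis
    by (metis dvd_mult_unit_iff mult.commute)
qed

lemma monic_content_factorization_unique:
  fixes h h' :: "'a::field poly poly"
  assumes "smult g h = smult g' h'" and "monic g" "monic g'" and "primitive h" "primitive h'"
  shows "g = g'" and "h = h'"
proof -
  have "g dvd g'" "g' dvd g"
    using assms smult_eq_smult_primitive_imp_dvd[of g h g' h']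
      smult_eq_smult_primitive_imp_dvd[of g' h' g h] by simp_all
  then show "g = g'"
    using assms by (intro poly_dvd_antisym) auto
  moreover have "g \<noteq> 0"
    using \<open>monic g\<close> by auto
  moreover have "[:g:] * h = [:g:] * h'"
    using assms(1) \<open>g = g'\<close> by simp
  ultimately show "h = h'"
    by (metis mult_left_cancel pCons_eq_0_iff)
qed

lemma irreducible_imp_primitive_idom:
  fixes p :: "'a::idom poly"
  assumes "irreducible p" and "degree p > 0"
  shows "primitive p"
  unfolding primitive_iff_const_dvd
proof (intro allI impI)
  fix c
  assume "[:c:] dvd p"
  then obtain r where p_eq: "p = [:c:] * r" ..
  then have "[:c:] dvd 1 \<or> r dvd 1"
    using assms(1) irreducibleD by blast
  moreover have "\<not> r dvd 1"
    using assms(2) p_eq by (auto simp: is_unit_poly_iff split: if_splits)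
  ultimately show "c dvd 1"
    by (simp add: is_unit_const_poly_iff)
qed

lemma monic_irreducible_map_poly_to_fract_iff:
  fixes f :: "'a::ufd poly"
  assumes "monic f" and "degree f > 0"
  shows "irreducible (map_poly to_fract f) \<longleftrightarrow> irreducible f"
proof -
  have "lead_coeff (map_poly to_fract f) = 1"
    using assms(1) by simp
  then have "1 \<in> set (coeffs (map_poly to_fract f))"
    by (metis coeff_0 coeff_in_coeffs le_refl zero_neq_one)
  then have "divides_ff (content_ff (map_poly to_fract f)) 1"
    by (rule content_ff_divides_ff)
  moreover obtain c where "content_ff (map_poly to_fract f) = to_fract c"
    using content_ff_map_poly_to_fract by blast
  ultimately have "content_ff (map_poly to_fract f) =dff 1"
    by (simp add: eq_dff_def flip: to_fract_1)
  then show ?thesis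
    using assms(2) by (simp add: irreducible_cases[of f])
qed

lemma monic_not_irreducible_factorization:
  fixes f :: "'a::idom poly"
  assumes "monic f" and "f \<noteq> 1" and "\<not> irreducible f"
  obtains g h where "f = g * h" and "monic g" "monic h" and "degree g > 0" "degree h > 0"
proof -
  have unit_iff: "p dvd 1 \<longleftrightarrow> p = 1" if "monic p" for p :: "'a poly"
    using that by (metis degree_pCons_0 dvd_refl is_unit_polyE monic_degree_0)
  have "f \<noteq> 0" "\<not> f dvd 1"
    using assms unit_iff by auto
  then obtain a b where f_eq: "f = a * b" and not_unit: "\<not> a dvd 1" "\<not> b dvd 1"
    using assms(3) by (auto simp: irreducible_def)
  have lead: "lead_coeff a * lead_coeff b = 1"
    using assms(1) by (simp add: f_eq lead_coeff_mult)
  then have "a \<noteq> 0" "b \<noteq> 0"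
    by auto
  define g where "g = smult (lead_coeff b) a"
  define h where "h = smult (lead_coeff a) b"
  have "f = g * h"
    using lead by (simp add: f_eq g_def h_def mult.commute)
  moreover have "monic g" "monic h"
    using lead \<open>a \<noteq> 0\<close> \<open>b \<noteq> 0\<close> by (simp_all add: g_def h_def mult.commute)
  moreover have "\<not> g dvd 1" "\<not> h dvd 1"
    using not_unit by (simp_all add: g_def h_def is_unit_smult_iff)
  ultimately show thesis
    using unit_iff monic_degree_0 by (intro that) blast+
qed

section \<open>Monic polynomials of bounded \<open>x\<close>-degree\<close>

definition monic_polys :: "nat \<Rightarrow> nat \<Rightarrow> 'a::comm_ring_1 poly poly set" where
  "monic_polys d n = {f. monic f \<and> degree f = n \<and> degree (swap_xy f) \<le> d}"

lemma card_polys_deg_le: "card (polys_deg_le d :: 'a::{field,finite} poly set) = CARD('a) ^ Suc d"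
proof (induction d)
  case 0
  have "bij_betw (\<lambda>c. [:c:]) (UNIV :: 'a set) (polys_deg_le 0)"
    by (rule bij_betwI'[where X = UNIV]) (auto simp: polys_deg_le_def elim: degree_eq_zeroE)
  then show ?case
    using bij_betw_same_card by fastforce
next
  case (Suc d)
  have "bij_betw (\<lambda>(c, p). pCons c p) (UNIV \<times> polys_deg_le d :: ('a \<times> 'a poly) set)
          (polys_deg_le (Suc d))"
  proof (rule bij_betwI', safe)
    fix p :: "'a poly" assume "p \<in> polys_deg_le (Suc d)"
    then show "\<exists>x\<in>UNIV \<times> polys_deg_le d. p = (case x of (c, p) \<Rightarrow> pCons c p)"
      by (cases p) (auto simp: polys_deg_le_def degree_pCons_eq_if split: if_splits)
  qed (auto simp: polys_deg_le_def degree_pCons_eq_if)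
  from bij_betw_same_card[OF this] show ?case
    using Suc by (simp add: card_cartesian_product)
qed

lemma coeff_monic_with_coeffs:
  "coeff (monic_with_coeffs n a) m = (if m = n then 1 else if m < n then a m else 0)"
  by (auto simp: monic_with_coeffs_def coeff_sum)

lemma bij_betw_monic_with_coeffs:
  "bij_betw (monic_with_coeffs n) (PiE_dflt {..<n} 0 (\<lambda>_. polys_deg_le d))
     (monic_polys d n :: 'a::{field,finite} poly poly set)"
  (is "bij_betw _ ?A ?B")
proof (rule bij_betw_byWitness[where f' = "\<lambda>f m. if m < n then coeff f m else 0"])
  show "\<forall>a\<in>?A. (\<lambda>m. if m < n then coeff (monic_with_coeffs n a) m else 0) = a"
    by (auto simp: coeff_monic_with_coeffs PiE_dflt_def)
  show "\<forall>f\<in>?B. monic_with_coeffs n (\<lambda>m. if m < n then coeff f m else 0) = f"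
    by (auto intro!: poly_eqI simp: coeff_monic_with_coeffs monic_polys_def coeff_eq_0)
  have "degree (monic_with_coeffs n a) = n" for a :: "nat \<Rightarrow> 'a poly"
    by (intro antisym degree_le le_degree) (auto simp: coeff_monic_with_coeffs)
  then show "monic_with_coeffs n ` ?A \<subseteq> ?B"
    by (auto simp: monic_polys_def degree_swap_xy_le_iff coeff_monic_with_coeffs PiE_dflt_def
        polys_deg_le_def)
  show "(\<lambda>f m. if m < n then coeff f m else 0) ` ?B \<subseteq> ?A"
    by (auto simp: monic_polys_def degree_swap_xy_le_iff PiE_dflt_def polys_deg_le_def)
qed

lemma finite_monic_polys [simp]: "finite (monic_polys d n :: 'a::{field,finite} poly poly set)"
  using bij_betw_finite[OF bij_betw_monic_with_coeffs[of n d]]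
  by (auto intro!: finite_PiE_dflt finite_polys_deg_le)

lemma card_monic_polys:
  "card (monic_polys d n :: 'a::{field,finite} poly poly set) = CARD('a) ^ (Suc d * n)"
  using bij_betw_same_card[OF bij_betw_monic_with_coeffs[of n d, where 'a = 'a]]
  by (simp only: card_PiE_dflt finite_polys_deg_le card_polys_deg_le finite_lessThan prod_constant
      card_lessThan power_mult)

lemma map_pmf_monic_with_coeffs_random_coeffs:
  "map_pmf (monic_with_coeffs n) (random_coeffs d n) =
     pmf_of_set (monic_polys d n :: 'a::{field,finite} poly poly set)"
proof -
  have nonempty: "(polys_deg_le d :: 'a poly set) \<noteq> {}"
    using zero_in_polys_deg_le by blast
  have "random_coeffs d n = pmf_of_set (PiE_dflt {..<n} 0 (\<lambda>_. polys_deg_le d :: 'a poly set))"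
    unfolding random_coeffs_def using nonempty
    by (intro Pi_pmf_of_set) (auto simp: finite_polys_deg_le)
  with nonempty show ?thesis
    by (auto intro!: map_pmf_of_set_bij_betw bij_betw_monic_with_coeffs finite_PiE_dflt
        finite_polys_deg_le)
qed

lemma prob_monic_with_coeffs:
  "measure_pmf.prob (random_coeffs d n :: (nat \<Rightarrow> 'a::{field,finite} poly) pmf)
     {a. P (monic_with_coeffs n a)} =
   real (card {f \<in> monic_polys d n. P f}) / real (card (monic_polys d n :: 'a poly poly set))"
proof -
  have "card (monic_polys d n :: 'a poly poly set) \<noteq> 0"
    by (simp add: card_monic_polys)
  then have "measure_pmf.prob (pmf_of_set (monic_polys d n :: 'a poly poly set)) {f. P f} =
      real (card (monic_polys d n \<inter> {f. P f})) / real (card (monic_polys d n :: 'a poly poly set))"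
    by (intro measure_pmf_of_set) auto
  then show ?thesis
    by (simp add: Int_def vimage_def flip: map_pmf_monic_with_coeffs_random_coeffs)
qed

lemma bij_betw_swap_xy_const:
  "bij_betw (\<lambda>g. swap_xy [:g:]) {g :: 'a::comm_ring_1 poly. monic g \<and> degree g = n}
     (monic_polys 0 n)"
proof (rule bij_betwI')
  show "swap_xy [:g:] = swap_xy [:g':] \<longleftrightarrow> g = g'" for g g' :: "'a poly"
    by simp
  show "swap_xy [:g:] \<in> monic_polys 0 n" if "g \<in> {g. monic g \<and> degree g = n}" for g :: "'a poly"
    using that by (auto simp: monic_polys_def)
  fix f :: "'a poly poly"
  assume f_mem: "f \<in> monic_polys 0 n"
  then have "degree (swap_xy f) = 0"
    by (simp add: monic_polys_def)
  then obtain g where "swap_xy f = [:g:]"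
    by (rule degree_eq_zeroE)
  then have f_eq: "f = swap_xy [:g:]"
    by (metis swap_xy_swap_xy)
  with f_mem show "\<exists>g\<in>{g. monic g \<and> degree g = n}. f = swap_xy [:g:]"
    by (auto simp: monic_polys_def)
qed

lemma swap_xy_const_mult_mem_monic_polys_iff:
  fixes g :: "'a::idom poly"
  assumes "monic g"
  shows "swap_xy [:g:] * h \<in> monic_polys d n \<longleftrightarrow> degree g \<le> n \<and> h \<in> monic_polys d (n - degree g)"
proof (cases "h = 0")
  case True
  then show ?thesis
    by (auto simp: monic_polys_def)
next
  case False
  have "g \<noteq> 0"
    using assms by auto
  then have "degree (swap_xy [:g:] * h) = degree g + degree h"
    using False by (simp add: degree_mult_eq)
  moreover have "lead_coeff (swap_xy [:g:] * h) = lead_coeff h"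
    using assms by (simp only: lead_coeff_mult) simp
  moreover have "degree (swap_xy (swap_xy [:g:] * h)) = degree (swap_xy h)"
    using \<open>g \<noteq> 0\<close> by (simp add: swap_xy.hom_mult)
  ultimately show ?thesis
    by (auto simp: monic_polys_def)
qed

section \<open>Primitive polynomials\<close>

definition primitive_monic_polys :: "nat \<Rightarrow> nat \<Rightarrow> 'a::comm_ring_1 poly poly set" where
  "primitive_monic_polys d n = {f \<in> monic_polys d n. primitive (swap_xy f)}"

lemma finite_primitive_monic_polys [simp]:
  "finite (primitive_monic_polys d n :: 'a::{field,finite} poly poly set)"
  by (simp add: primitive_monic_polys_def)

lemma y_content_factorization:
  fixes f :: "'a::field poly poly"
  assumes "f \<noteq> 0"
  obtains g h where "monic g" and "primitive (swap_xy h)" and "f = swap_xy [:g:] * h"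
proof -
  have "swap_xy f \<noteq> 0"
    using assms by simp
  then obtain g p where "monic g" "primitive p" and swap_f: "swap_xy f = smult g p"
    by (rule monic_content_factorization)
  have "f = swap_xy (swap_xy f)"
    by simp
  also have "\<dots> = swap_xy ([:g:] * p)"
    by (simp add: swap_f)
  also have "\<dots> = swap_xy [:g:] * swap_xy p"
    by (rule swap_xy.hom_mult)
  finally have "f = swap_xy [:g:] * swap_xy p" .
  with \<open>monic g\<close> \<open>primitive p\<close> show thesis
    by (intro that[of g "swap_xy p"]) simp_all
qed

lemma y_content_factorization_unique:
  fixes h h' :: "'a::field poly poly"
  assumes "swap_xy [:g:] * h = swap_xy [:g':] * h'" and "monic g" "monic g'"
    and "primitive (swap_xy h)" "primitive (swap_xy h')"
  shows "g = g'" and "h = h'"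
proof -
  have "swap_xy (swap_xy [:g:] * h) = swap_xy (swap_xy [:g':] * h')"
    by (simp only: assms(1))
  then have "smult g (swap_xy h) = smult g' (swap_xy h')"
    by (simp add: swap_xy.hom_mult)
  from monic_content_factorization_unique[OF this assms(2-5)] show "g = g'" and "h = h'"
    by simp_all
qed

lemma bij_betw_content_times_primitive:
  "bij_betw (\<lambda>(k, g, h). swap_xy [:g:] * h)
     (SIGMA k:{..n}. {g. monic g \<and> degree g = k} \<times> primitive_monic_polys d (n - k))
     (monic_polys d n :: 'a::field poly poly set)"
  (is "bij_betw ?mult ?triples _")
proof (rule bij_betw_imageI)
  show "inj_on ?mult ?triples"
    using y_content_factorization_unique by (fastforce simp: inj_on_def primitive_monic_polys_def)
  show "?mult ` ?triples = monic_polys d n"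
  proof (intro equalityI subsetI)
    fix f
    assume "f \<in> ?mult ` ?triples"
    then show "f \<in> monic_polys d n"
      by (auto simp: primitive_monic_polys_def swap_xy_const_mult_mem_monic_polys_iff)
  next
    fix f :: "'a poly poly"
    assume f_mem: "f \<in> monic_polys d n"
    then have "f \<noteq> 0"
      by (auto simp: monic_polys_def)
    then obtain g h where content: "monic g" "primitive (swap_xy h)" "f = swap_xy [:g:] * h"
      by (rule y_content_factorization)
    then have "degree g \<le> n" "h \<in> primitive_monic_polys d (n - degree g)"
      using f_mem by (simp_all add: primitive_monic_polys_def swap_xy_const_mult_mem_monic_polys_iff)
    then show "f \<in> ?mult ` ?triples"
      using content by (intro image_eqI[of _ _ "(degree g, g, h)"]) auto
  qed
qed

lemma card_monic_polys_eq_sum_primitive: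
  "card (monic_polys d n :: 'a::{field,finite} poly poly set) =
     (\<Sum>k\<le>n. CARD('a) ^ k * card (primitive_monic_polys d (n - k) :: 'a poly poly set))"
proof -
  have "card {g :: 'a poly. monic g \<and> degree g = k} = CARD('a) ^ k"
    and "finite {g :: 'a poly. monic g \<and> degree g = k}" for k
    using bij_betw_same_card[OF bij_betw_swap_xy_const[of k, where 'a = 'a]]
      bij_betw_finite[OF bij_betw_swap_xy_const[of k, where 'a = 'a]]
    by (simp_all add: card_monic_polys)
  then show ?thesis
    using bij_betw_same_card[OF bij_betw_content_times_primitive[of n d, where 'a = 'a]]
    by (simp add: card_cartesian_product)
qed

lemma card_primitive_monic_polys_Suc:
  "card (primitive_monic_polys d (Suc n) :: 'a::{field,finite} poly poly set)
     + CARD('a) * CARD('a) ^ (Suc d * n) = CARD('a) ^ (Suc d * Suc n)"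
proof -
  let ?prim = "\<lambda>m. card (primitive_monic_polys d m :: 'a poly poly set)"
  have "CARD('a) ^ (Suc d * Suc n) = (\<Sum>k\<le>Suc n. CARD('a) ^ k * ?prim (Suc n - k))"
    by (simp only: card_monic_polys_eq_sum_primitive flip: card_monic_polys)
  also have "\<dots> = ?prim (Suc n) + (\<Sum>k\<le>n. CARD('a) ^ Suc k * ?prim (n - k))"
    by (subst sum.atMost_Suc_shift) simp
  also have "(\<Sum>k\<le>n. CARD('a) ^ Suc k * ?prim (n - k))
      = CARD('a) * (\<Sum>k\<le>n. CARD('a) ^ k * ?prim (n - k))"
    by (simp add: sum_distrib_left mult.assoc)
  also have "(\<Sum>k\<le>n. CARD('a) ^ k * ?prim (n - k)) = CARD('a) ^ (Suc d * n)"
    by (simp only: card_monic_polys_eq_sum_primitive flip: card_monic_polys)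
  finally show ?thesis
    by simp
qed

lemma primitive_monic_polys_density:
  assumes "n > 0"
  shows "real (card (primitive_monic_polys d n :: 'a::{field,finite} poly poly set))
     / real (card (monic_polys d n :: 'a poly poly set)) = 1 - 1 / real CARD('a) ^ d"
proof -
  obtain m where n_eq: "n = Suc m"
    using assms gr0_implies_Suc by blast
  have "real (card (primitive_monic_polys d n :: 'a poly poly set))
      = real CARD('a) ^ (Suc d * n) - real CARD('a) * real CARD('a) ^ (Suc d * m)"
    using arg_cong[OF card_primitive_monic_polys_Suc[of d m, where 'a = 'a], of real]
    by (simp add: n_eq)
  then show ?thesis
    by (simp add: card_monic_polys n_eq power_add field_simps)
qed

section \<open>Irreducible polynomials\<close>

definition monic_products :: "nat \<Rightarrow> nat \<Rightarrow> 'a::comm_ring_1 poly poly set" where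
  "monic_products d n = (\<Union>k\<in>{1..n}. (\<lambda>(g, h). g * h) ` (monic_polys d k \<times> monic_polys d (n - k)))"

definition irreducible_monic_polys :: "nat \<Rightarrow> nat \<Rightarrow> 'a::comm_ring_1 poly poly set" where
  "irreducible_monic_polys d n = {f \<in> monic_polys d n. irreducible f}"

lemma finite_irreducible_monic_polys [simp]:
  "finite (irreducible_monic_polys d n :: 'a::{field,finite} poly poly set)"
  by (simp add: irreducible_monic_polys_def)

lemma irreducible_over_rational_functions_iff:
  assumes "f \<in> monic_polys d n" and "n > 0"
  shows "irreducible_over_rational_functions f \<longleftrightarrow> irreducible f"
proof -
  have "monic f" "degree f > 0"
    using assms by (auto simp: monic_polys_def)
  then show ?thesis
    by (simp add: irreducible_over_rational_functions_def monic_irreducible_map_poly_to_fract_iff)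
qed

lemma irreducible_subset_primitive_Un:
  "irreducible_monic_polys d n
    \<subseteq> primitive_monic_polys d n \<union> (monic_polys 0 n :: 'a::idom poly poly set)"
proof
  fix f :: "'a poly poly"
  assume f_mem: "f \<in> irreducible_monic_polys d n"
  then have "irreducible (swap_xy f)"
    by (simp add: irreducible_monic_polys_def)
  then have "primitive (swap_xy f) \<or> degree (swap_xy f) = 0"
    using irreducible_imp_primitive_idom by blast
  then show "f \<in> primitive_monic_polys d n \<union> monic_polys 0 n"
    using f_mem by (auto simp: irreducible_monic_polys_def primitive_monic_polys_def monic_polys_def)
qed

lemma degree_swap_xy_pos_if_dvd_primitive:
  fixes f :: "'a::idom poly poly"
  assumes "primitive (swap_xy f)" and "g dvd f" and "\<not> g dvd 1"
  shows "degree (swap_xy g) > 0"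
proof (rule ccontr)
  assume "\<not> degree (swap_xy g) > 0"
  then obtain c where swap_g: "swap_xy g = [:c:]"
    by (auto elim: degree_eq_zeroE)
  then have "[:c:] dvd swap_xy f"
    using swap_xy.hom_dvd[OF assms(2)] by simp
  then have "[:c:] dvd 1"
    using assms(1) by (simp add: primitive_iff_const_dvd is_unit_const_poly_iff)
  then show False
    using assms(3) swap_xy.is_unit_hom_iff[of g] swap_g by simp
qed

lemma primitive_subset_irreducible_Un_products:
  assumes "n > 0"
  shows "primitive_monic_polys d n
    \<subseteq> irreducible_monic_polys d n \<union> (monic_products (d - 1) n :: 'a::idom poly poly set)"
proof
  fix f :: "'a poly poly"
  assume "f \<in> primitive_monic_polys d n"
  then have f_mem: "f \<in> monic_polys d n" and prim: "primitive (swap_xy f)"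
    by (auto simp: primitive_monic_polys_def)
  then have "monic f" "degree f = n" "degree (swap_xy f) \<le> d"
    by (auto simp: monic_polys_def)
  show "f \<in> irreducible_monic_polys d n \<union> monic_products (d - 1) n"
  proof (cases "irreducible f")
    case True
    then show ?thesis
      using f_mem by (simp add: irreducible_monic_polys_def)
  next
    case False
    have "f \<noteq> 1"
      using \<open>degree f = n\<close> assms by auto
    then obtain g h where f_eq: "f = g * h" and "monic g" "monic h" "degree g > 0" "degree h > 0"
      by (rule monic_not_irreducible_factorization[OF \<open>monic f\<close> _ False])
    have "g \<noteq> 0" "h \<noteq> 0"
      using \<open>monic g\<close> \<open>monic h\<close> by auto
    then have y_degrees: "degree g + degree h = n"
      and x_degrees: "degree (swap_xy g) + degree (swap_xy h) \<le> d"
      using \<open>degree f = n\<close> \<open>degree (swap_xy f) \<le> d\<close>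
      by (simp_all add: f_eq degree_mult_eq swap_xy.hom_mult)
    have "\<not> g dvd 1" "\<not> h dvd 1"
      using \<open>degree g > 0\<close> \<open>degree h > 0\<close> by (auto simp: is_unit_poly_iff)
    then have "degree (swap_xy g) > 0" "degree (swap_xy h) > 0"
      using degree_swap_xy_pos_if_dvd_primitive[OF prim] by (simp_all add: f_eq)
    then have "(g, h) \<in> monic_polys (d - 1) (degree g) \<times> monic_polys (d - 1) (n - degree g)"
      using \<open>monic g\<close> \<open>monic h\<close> x_degrees y_degrees by (auto simp: monic_polys_def)
    moreover have "degree g \<in> {1..n}"
      using \<open>degree g > 0\<close> y_degrees by simp
    ultimately show ?thesis
      unfolding f_eq monic_products_def by force
  qed
qed

lemma finite_monic_products [simp]:
  "finite (monic_products d n :: 'a::{field,finite} poly poly set)"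
  by (simp add: monic_products_def)

lemma card_monic_products_le:
  "card (monic_products d n :: 'a::{field,finite} poly poly set) \<le> n * CARD('a) ^ (Suc d * n)"
proof -
  let ?pairs = "\<lambda>k. monic_polys d k \<times> monic_polys d (n - k) :: ('a poly poly \<times> 'a poly poly) set"
  let ?products = "\<lambda>k. (\<lambda>(g, h). g * h) ` ?pairs k"
  have "card (?products k) \<le> CARD('a) ^ (Suc d * n)" if "k \<in> {1..n}" for k
  proof -
    have "card (?products k) \<le> card (?pairs k)"
      by (rule card_image_le) simp
    also have "\<dots> = CARD('a) ^ (Suc d * (k + (n - k)))"
      by (simp only: card_cartesian_product card_monic_polys power_add distrib_left)
    finally show ?thesis
      using that by simp
  qed
  then have "(\<Sum>k\<in>{1..n}. card (?products k)) \<le> n * CARD('a) ^ (Suc d * n)"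
    using sum_bounded_above[of "{1..n}" "\<lambda>k. card (?products k)"] by simp
  then show ?thesis
    using card_UN_le[of "{1..n}" ?products] by (simp add: monic_products_def)
qed

lemma card_irreducible_minus_card_primitive_le:
  assumes "d \<ge> 1" and "n > 0"
  shows "\<bar>real (card (irreducible_monic_polys d n :: 'a::{field,finite} poly poly set))
      - real (card (primitive_monic_polys d n :: 'a poly poly set))\<bar>
    \<le> real (n * CARD('a) ^ (d * n))"
  (is "\<bar>real (card ?irr) - real (card ?prim)\<bar> \<le> real ?bound")
proof -
  have "card (monic_polys 0 n :: 'a poly poly set) = CARD('a) ^ (1 * n)"
    by (simp add: card_monic_polys)
  also have "\<dots> \<le> 1 * CARD('a) ^ (d * n)"
    using assms by (simp add: power_increasing Suc_le_eq)
  also have "\<dots> \<le> ?bound"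
    using assms by (intro mult_right_mono) auto
  finally have "card (monic_polys 0 n :: 'a poly poly set) \<le> ?bound" .
  moreover have "card (monic_products (d - 1) n :: 'a poly poly set) \<le> ?bound"
    using card_monic_products_le[of "d - 1" n, where 'a = 'a] assms(1) by simp
  moreover have "card ?irr \<le> card ?prim + card (monic_polys 0 n :: 'a poly poly set)"
    using card_mono[OF _ irreducible_subset_primitive_Un] card_Un_le
    by (rule order_trans) simp
  moreover have "card ?prim \<le> card ?irr + card (monic_products (d - 1) n :: 'a poly poly set)"
    using card_mono[OF _ primitive_subset_irreducible_Un_products[OF assms(2)]] card_Un_le
    by (rule order_trans) simp
  ultimately show ?thesis
    by linarith
qed

lemma prob_irreducible_error_bound:
  assumes "d \<ge> 1" and "n > 0"
  shows "\<bar>measure_pmf.prob (random_coeffs d n :: (nat \<Rightarrow> 'a::{field,finite} poly) pmf)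
        {a. irreducible_over_rational_functions (monic_with_coeffs n a)}
      - (1 - 1 / real CARD('a) ^ d)\<bar> \<le> real n * (1 / real CARD('a)) ^ n"
  (is "\<bar>?prob - _\<bar> \<le> _")
proof -
  let ?irr = "card (irreducible_monic_polys d n :: 'a poly poly set)"
  let ?prim = "card (primitive_monic_polys d n :: 'a poly poly set)"
  let ?all = "card (monic_polys d n :: 'a poly poly set)"
  have "{f \<in> monic_polys d n :: 'a poly poly set. irreducible_over_rational_functions f}
      = irreducible_monic_polys d n"
    using irreducible_over_rational_functions_iff assms(2)
    by (auto simp: irreducible_monic_polys_def)
  then have "?prob = real ?irr / real ?all"
    by (simp only: prob_monic_with_coeffs)
  then have "\<bar>?prob - (1 - 1 / real CARD('a) ^ d)\<bar> = \<bar>real ?irr - real ?prim\<bar> / real ?all"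
    by (simp flip: primitive_monic_polys_density[OF assms(2), of d, where 'a = 'a]
        diff_divide_distrib)
  also have "\<dots> \<le> real (n * CARD('a) ^ (d * n)) / real ?all"
    using card_irreducible_minus_card_primitive_le[OF assms] by (rule divide_right_mono) simp
  also have "\<dots> = real n * (1 / real CARD('a)) ^ n"
    by (simp add: card_monic_polys power_add power_one_over field_simps)
  finally show ?thesis .
qed

theorem theorem1p2:
  fixes d q :: nat
  assumes "d \<ge> 1"
    and "q = CARD('a::{field,finite})"
  shows "(\<lambda>n. measure_pmf.prob (random_coeffs d n :: (nat \<Rightarrow> 'a poly) pmf)
              {a. irreducible_over_rational_functions (monic_with_coeffs n a)})
         \<longlonglongrightarrow> 1 - 1 / real q ^ d"
proof -
  let ?prob = "\<lambda>n. measure_pmf.prob (random_coeffs d n :: (nat \<Rightarrow> 'a poly) pmf)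
              {a. irreducible_over_rational_functions (monic_with_coeffs n a)}"
  have "card {0, 1 :: 'a} \<le> q"
    unfolding assms(2) by (rule card_mono) auto
  then have "(\<lambda>n. real n * (1 / real q) ^ n) \<longlonglongrightarrow> 0"
    by (intro powser_times_n_limit_0) auto
  moreover have "\<forall>\<^sub>F n in sequentially.
      norm (?prob n - (1 - 1 / real q ^ d)) \<le> real n * (1 / real q) ^ n"
    using prob_irreducible_error_bound[OF assms(1), where 'a = 'a]
    by (intro eventually_mono[OF eventually_gt_at_top[of 0]]) (simp add: assms(2))
  ultimately have "(\<lambda>n. ?prob n - (1 - 1 / real q ^ d)) \<longlonglongrightarrow> 0"
    by (rule Lim_null_comparison[rotated])
  then show ?thesis
    by (rule LIM_zero_cancel)
qed

end
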